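(* Let $d>1$ be an integer. For any integer $k\ge1$ and any real $\lambda>0$, \[ a_{k,\lambda} \le \min\{1,\; k\, g_{\max}/\lambda\}. \]
   Context: For $V \subseteq \mathbb{R}^d$ and $r>0$, $G_r(V)$ is the graph with vertex set $V$ in which two distinct points $u,v\in V$ are adjacent if and only if $\|u-v\|\le r$ (Euclidean norm). For $k \in \mathbb{N}=\{1,2,\dots\}$ and finite $V$, $N_{k,r}(V)$ is the maximum number of vertices of $G_r(V)$ that can be properly colored with $k$ colors, i.e., the largest cardinality of a subset $U\subseteq V$ such that the induced subgraph $G_r(U)$ is $k$-colorable. $\mathcal{X}_\lambda$ is a Poisson point process of (constant) intensity $\lambda$ in $\mathbb{R}^d$. Set $F_{k,\lambda}(t) = N_{k,1}([0,t]^d \cap \mathcal{X}_\lambda)$ and $\overline{F}_{k,\lambda}(t) = \mathbb{E}\{F_{k,\lambda}(t)\}/(\lambda t^d)$ for $t>0$. The constant is $a_{k,\lambda} = \inf_{t>0}\overline{F}_{k,\lambda}(t)$, which also equals $\lim_{t\to\infty}\overline{F}_{k,\lambda}(t)$. The number $g_{\max}$ is the maximum density of a set of points $V\subseteq\mathbb{R}_+^d$ such that no two points of $V$ are within distance $1$, i.e., the supremum, over all $V\subseteq [0,\infty)^d$ with $\|u-v\|>1$ for all distinct $u,v\in V$, of $\limsup_{t\to\infty} |V\cap[0,t]^d|/t^d$. *)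

theory Defs
  imports "HOL-Probability.Probability"
begin

text \<open>Simple graphs are pairs of a vertex set and a set of edges, an edge being a
  two-element set of vertices.\<close>

type_synonym 'a graph = "'a set \<times> 'a set set"

definition geometric_graph :: "real \<Rightarrow> 'a::real_normed_vector set \<Rightarrow> 'a graph" where
  "geometric_graph r V = (V, {{u, v} | u v. u \<in> V \<and> v \<in> V \<and> u \<noteq> v \<and> norm (u - v) \<le> r})"

definition colorable :: "nat \<Rightarrow> 'a graph \<Rightarrow> bool" where
  "colorable k G \<longleftrightarrow>
     (\<exists>c :: 'a \<Rightarrow> nat. (\<forall>v \<in> fst G. c v < k) \<and> (\<forall>u v. {u, v} \<in> snd G \<longrightarrow> c u \<noteq> c v))"

text \<open>Meaningful for finite \<open>V\<close> only; the set is then finite, and nonempty because of \<open>U = {}\<close>.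
  The subgraph of \<open>geometric_graph r V\<close> induced by \<open>U \<subseteq> V\<close> is \<open>geometric_graph r U\<close>.\<close>

definition max_colorable :: "nat \<Rightarrow> real \<Rightarrow> 'a::real_normed_vector set \<Rightarrow> nat" where
  "max_colorable k r V = Max {card U | U. U \<subseteq> V \<and> colorable k (geometric_graph r U)}"

definition cube :: "real \<Rightarrow> (real ^ 'n) set" where
  "cube t = {x. \<forall>i. 0 \<le> x $ i \<and> x $ i \<le> t}"

text \<open>A homogeneous Poisson point process of intensity \<open>l\<close>, as a random locally finite set
  of points (homogeneous Poisson processes have no multiple points): counts of bounded Borel
  sets are Poisson distributed, and those of disjoint sets are independent. For a null set the
  formula in \<open>poisson_counts\<close> gives the point mass at 0, since \<open>0 ^ 0 = 1\<close>.\<close>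

locale poisson_point_process = prob_space M
  for M :: "'w measure" +
  fixes l :: real and X :: "'w \<Rightarrow> (real ^ 'n::finite) set"
  assumes locally_finite:
    "\<And>\<omega> B. \<omega> \<in> space M \<Longrightarrow> bounded B \<Longrightarrow> finite (X \<omega> \<inter> B)"
  and measurable_counts:
    "\<And>B. B \<in> sets borel \<Longrightarrow> bounded B \<Longrightarrow>
       (\<lambda>\<omega>. card (X \<omega> \<inter> B)) \<in> M \<rightarrow>\<^sub>M count_space UNIV"
  and poisson_counts:
    "\<And>B n. B \<in> sets borel \<Longrightarrow> bounded B \<Longrightarrow>
       prob {\<omega> \<in> space M. card (X \<omega> \<inter> B) = n} =
         (l * measure lborel B) ^ n / fact n * exp (- (l * measure lborel B))"
  and independent_counts:
    "\<And>\<B>. finite \<B> \<Longrightarrow> disjoint \<B> \<Longrightarrow> (\<And>B. B \<in> \<B> \<Longrightarrow> B \<in> sets borel \<and> bounded B) \<Longrightarrow>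
       indep_vars (\<lambda>_. count_space UNIV) (\<lambda>B \<omega>. card (X \<omega> \<inter> B)) \<B>"

definition F_count :: "('w \<Rightarrow> (real ^ 'n::finite) set) \<Rightarrow> nat \<Rightarrow> real \<Rightarrow> 'w \<Rightarrow> nat" where
  "F_count X k t \<omega> = max_colorable k 1 (cube t \<inter> X \<omega>)"

text \<open>For a Poisson process \<open>X\<close> the integrand is measurable (\<open>F_count X k t \<omega> \<ge> m\<close> is a countable
  union, over suitable \<open>m\<close>-tuples of disjoint rational boxes, of events about counts) and dominated by
  the integrable \<open>card (cube t \<inter> X \<omega>)\<close>, so the Bochner integral is the genuine expectation.\<close>

definition F_mean ::
  "'w measure \<Rightarrow> real \<Rightarrow> ('w \<Rightarrow> (real ^ 'n::finite) set) \<Rightarrow> nat \<Rightarrow> real \<Rightarrow> real" where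
  "F_mean M l X k t =
     (\<integral>\<omega>. real (F_count X k t \<omega>) \<partial>M) / (l * t ^ CARD('n))"

definition a_const ::
  "'w measure \<Rightarrow> real \<Rightarrow> ('w \<Rightarrow> (real ^ 'n::finite) set) \<Rightarrow> nat \<Rightarrow> real" where
  "a_const M l X k = (INF t \<in> {0<..}. F_mean M l X k t)"

definition separated_set :: "(real ^ 'n::finite) set \<Rightarrow> bool" where
  "separated_set V \<longleftrightarrow> (\<forall>u \<in> V. \<forall>v \<in> V. u \<noteq> v \<longrightarrow> norm (u - v) > 1)"

definition upper_density :: "(real ^ 'n::finite) set \<Rightarrow> ereal" where
  "upper_density V = Limsup at_top (\<lambda>t::real. ereal (real (card (V \<inter> cube t)) / t ^ CARD('n)))"

definition g_max :: "'n::finite itself \<Rightarrow> ereal" where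
  "g_max _ = (SUP V \<in> {V :: (real ^ 'n) set. (\<forall>x \<in> V. \<forall>i. 0 \<le> x $ i) \<and> separated_set V}.
     upper_density V)"

end

theory Submission
  imports Defs "HOL-Real_Asymp.Real_Asymp"
begin

text \<open>A \<open>k\<close>-colourable set is a union of \<open>k\<close> separated sets. Repeating a finite separated subset
  \<open>S\<close> of \<open>[0, t]\<^sup>d\<close> with period \<open>t + 2\<close> in each direction gives a separated subset of the orthant,
  so \<open>card S / (t + 2)\<^sup>d \<le> g_max\<close>. Hence \<open>F_count X k t \<le> k * g_max * (t + 2)\<^sup>d\<close> surely; divide by
  \<open>l * t\<^sup>d\<close> and let \<open>t\<close> tend to infinity. The bound by 1 is the mean number of points in the cube.\<close>

section \<open>Cubes and their volume\<close>

lemma cube_eq_cbox: "cube t = cbox 0 (\<chi> i. t)"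
  by (auto simp: cube_def mem_box_cart)

lemma measure_cube:
  assumes "t \<ge> 0"
  shows "measure lborel (cube t :: (real ^ 'n::finite) set) = t ^ CARD('n)"
proof -
  have "(cbox 0 (\<chi> i. t) :: (real ^ 'n) set) \<noteq> {}"
    using assms by (auto simp: interval_ne_empty_cart)
  then show ?thesis
    unfolding cube_eq_cbox by (simp add: content_cbox_cart)
qed

section \<open>Colourable sets and separated sets\<close>

lemma card_le_max_colorable_imp_le:
  assumes "finite V" and "\<And>U. U \<subseteq> V \<Longrightarrow> colorable k (geometric_graph r U) \<Longrightarrow> real (card U) \<le> b"
  shows "real (max_colorable k r V) \<le> b"
proof -
  let ?A = "{card U | U. U \<subseteq> V \<and> colorable k (geometric_graph r U)}"
  have "finite ?A"
    using assms(1) by (auto intro!: finite_subset[of ?A "card ` Pow V"])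
  \<comment> \<open>The empty set is colourable for every \<open>k\<close>, even
    \<open>k = 0\<close>, so the maximum is taken over a nonempty set and is attained.\<close>
  moreover have "colorable k (geometric_graph r ({} :: 'a set))"
    by (auto simp: colorable_def geometric_graph_def)
  then have "?A \<noteq> {}"
    by blast
  ultimately have "max_colorable k r V \<in> ?A"
    unfolding max_colorable_def by (rule Max_in)
  then show ?thesis
    using assms(2) by auto
qed

lemma max_colorable_le_card:
  assumes "finite V"
  shows "max_colorable k r V \<le> card V"
  using card_le_max_colorable_imp_le[of V k r "real (card V)"] assms
  by (simp add: card_mono)

text \<open>Points of one colour are pairwise non-adjacent, hence more than 1 apart; the
  \<open>k\<close> colour classes cover \<open>U\<close>, and \<open>b\<close> bounds each of
  them.\<close>

lemma card_colorable_le: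
  fixes U :: "(real ^ 'n::finite) set"
  assumes "finite U" and "colorable k (geometric_graph 1 U)"
    and "\<And>S. S \<subseteq> U \<Longrightarrow> separated_set S \<Longrightarrow> real (card S) \<le> b"
  shows "real (card U) \<le> real k * b"
proof -
  obtain c :: "real ^ 'n \<Rightarrow> nat" where c: "\<And>v. v \<in> U \<Longrightarrow> c v < k"
    and edge: "\<And>u v. {u, v} \<in> snd (geometric_graph 1 U) \<Longrightarrow> c u \<noteq> c v"
    using assms(2) by (auto simp: colorable_def geometric_graph_def)
  have "norm (u - v) > 1" if "u \<in> U" "v \<in> U" "u \<noteq> v" "c u = c v" for u v
    using that edge[of u v] by (fastforce simp: geometric_graph_def)
  then have "separated_set {u \<in> U. c u = i}" for i
    by (auto simp: separated_set_def)
  then have class_le: "real (card {u \<in> U. c u = i}) \<le> b" for i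
    by (intro assms(3)) auto
  have "U = (\<Union>i<k. {u \<in> U. c u = i})"
    using c by auto
  then have "card U \<le> (\<Sum>i<k. card {u \<in> U. c u = i})"
    using card_UN_le[of "{..<k}" "\<lambda>i. {u \<in> U. c u = i}"] by simp
  then have "real (card U) \<le> (\<Sum>i<k. real (card {u \<in> U. c u = i}))"
    unfolding of_nat_sum[symmetric] of_nat_le_iff .
  also have "\<dots> \<le> (\<Sum>i<k. b)"
    by (intro sum_mono class_le)
  finally show ?thesis by simp
qed

section \<open>Periodic repetition of a separated set\<close>

text \<open>The index \<open>z\<close> has natural coordinates, so that for \<open>s > 0\<close> the
  translates of a set in the orthant remain in the orthant.\<close>

definition lattice_shift :: "real \<Rightarrow> ('n::finite \<Rightarrow> nat) \<Rightarrow> real ^ 'n \<Rightarrow> real ^ 'n" where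
  "lattice_shift s z x = x + (\<chi> i. s * real (z i))"

text \<open>In a coordinate where \<open>z\<close> and \<open>w\<close> differ, the shifts differ by
  at least \<open>t + 2\<close>, while \<open>x\<close> and \<open>y\<close> differ by at most
  \<open>t\<close>. This leaves a gap of at least 2.\<close>

lemma norm_lattice_shift_diff:
  fixes x y :: "real ^ 'n::finite"
  assumes "x \<in> cube t" "y \<in> cube t" "z \<noteq> w"
  shows "norm (lattice_shift (t + 2) z x - lattice_shift (t + 2) w y) > 1"
proof -
  obtain i where i: "z i \<noteq> w i"
    using assms(3) by auto
  have xy: "0 \<le> x $ i" "x $ i \<le> t" "0 \<le> y $ i" "y $ i \<le> t"
    using assms(1,2) by (auto simp: cube_def)
  let ?d = "real (z i) - real (w i)"
  have "\<bar>?d\<bar> \<ge> 1"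
    using i by linarith
  then have "\<bar>(t + 2) * ?d\<bar> \<ge> t + 2"
    using xy by (simp add: abs_mult)
  then have "1 < \<bar>(x $ i - y $ i) + (t + 2) * ?d\<bar>"
    using xy by linarith
  also have "\<dots> = \<bar>(lattice_shift (t + 2) z x - lattice_shift (t + 2) w y) $ i\<bar>"
    by (simp add: lattice_shift_def algebra_simps)
  also have "\<dots> \<le> norm (lattice_shift (t + 2) z x - lattice_shift (t + 2) w y)"
    by (rule component_le_norm_cart)
  finally show ?thesis .
qed

text \<open>With \<open>s = t + 2\<close>, a cube of side \<open>N * s\<close> contains at least
  \<open>N ^ d\<close> disjoint translates of \<open>S\<close>. The density is thus at least
  \<open>card S / s ^ d\<close> along the sequence \<open>N * s\<close>, which suffices for a limit
  superior.\<close>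

lemma card_separated_le_g_max:
  fixes S :: "(real ^ 'n::finite) set"
  assumes "finite S" "S \<subseteq> cube t" "separated_set S" "t > 0"
  shows "ereal (real (card S) / (t + 2) ^ CARD('n)) \<le> g_max TYPE('n)"
proof -
  define s where "s = t + 2"
  define \<phi> :: "('n \<Rightarrow> nat) \<times> (real ^ 'n) \<Rightarrow> real ^ 'n" where "\<phi> = (\<lambda>(z, x). lattice_shift s z x)"
  define V where "V = \<phi> ` (UNIV \<times> S)"
  have s: "s > 0"
    using assms(4) by (simp add: s_def)
  have S: "0 \<le> x $ i" "x $ i \<le> t" if "x \<in> S" for x i
    using that assms(2) by (auto simp: cube_def)
  have far: "norm (\<phi> (z, x) - \<phi> (w, y)) > 1" if "x \<in> S" "y \<in> S" "z \<noteq> w" for z w x y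
    using norm_lattice_shift_diff[of x t y z w] that assms(2) by (auto simp: \<phi>_def s_def)
  have inj: "inj_on \<phi> (UNIV \<times> S)"
  proof (rule inj_onI, clarsimp)
    fix z w x y
    assume "x \<in> S" "y \<in> S" and eq: "\<phi> (z, x) = \<phi> (w, y)"
    then have "z = w"
      using far[of x y z w] by force
    with eq show "z = w \<and> x = y"
      by (simp add: \<phi>_def lattice_shift_def)
  qed
  have sep: "separated_set V"
    unfolding separated_set_def
  proof (intro ballI impI)
    fix u v assume "u \<in> V" "v \<in> V" "u \<noteq> v"
    then obtain z x w y where u: "u = \<phi> (z, x)" "x \<in> S" and v: "v = \<phi> (w, y)" "y \<in> S"
      by (auto simp: V_def)
    show "norm (u - v) > 1"
    proof (cases "z = w")
      case True
      then have "u - v = x - y"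
        by (simp add: u v \<phi>_def lattice_shift_def)
      moreover have "norm (x - y) > 1"
        using \<open>u \<noteq> v\<close> True u v assms(3) by (auto simp: separated_set_def)
      ultimately show ?thesis by simp
    next
      case False
      then show ?thesis using far u v by simp
    qed
  qed
  have nonneg: "\<forall>x \<in> V. \<forall>i. 0 \<le> x $ i"
    using S s by (auto simp: V_def \<phi>_def lattice_shift_def)
  have card_V: "real N ^ CARD('n) * real (card S) \<le> real (card (V \<inter> cube (real N * s)))" for N :: nat
  proof -
    \<comment> \<open>Indices below \<open>N\<close> give translates lying inside the cube. Indices
      up to \<open>N\<close> are needed to cover all points of \<open>V\<close> in it, as the closed
      cube may meet the next layer on its boundary. The cover only serves finiteness, without which
      \<open>card\<close> would be 0.\<close>
    let ?Z = "PiE (UNIV :: 'n set) (\<lambda>_. {..<N})" and ?Z' = "PiE (UNIV :: 'n set) (\<lambda>_. {..N})"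
    have "V \<inter> cube (real N * s) \<subseteq> \<phi> ` (?Z' \<times> S)"
    proof
      fix v assume v: "v \<in> V \<inter> cube (real N * s)"
      then obtain z x where zx: "v = \<phi> (z, x)" "x \<in> S"
        by (auto simp: V_def)
      have "z i \<le> N" for i
      proof -
        have "x $ i + s * real (z i) \<le> real N * s"
          using v zx by (auto simp: cube_def \<phi>_def lattice_shift_def)
        then have "s * real (z i) \<le> s * real N"
          using S[OF zx(2), of i] by (simp add: mult.commute)
        then show ?thesis using s by simp
      qed
      then show "v \<in> \<phi> ` (?Z' \<times> S)"
        using zx by auto
    qed
    moreover have "finite (?Z' \<times> S)"
      using assms(1) by (intro finite_cartesian_product finite_PiE) auto
    ultimately have fin: "finite (V \<inter> cube (real N * s))"
      by (meson finite_imageI finite_subset)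
    have "\<phi> ` (?Z \<times> S) \<subseteq> V \<inter> cube (real N * s)"
    proof (rule image_subsetI, clarsimp)
      fix z x assume z: "z \<in> ?Z" and x: "x \<in> S"
      have "x $ i + s * real (z i) \<le> real N * s" for i
      proof -
        have "z i < N"
          using z by auto
        then have "real (z i) + 1 \<le> real N"
          by linarith
        then have "(real (z i) + 1) * s \<le> real N * s"
          using s by (intro mult_right_mono) auto
        moreover have "x $ i \<le> s"
          using S[OF x, of i] by (simp add: s_def)
        ultimately show ?thesis by (simp add: algebra_simps)
      qed
      then show "\<phi> (z, x) \<in> V \<and> \<phi> (z, x) \<in> cube (real N * s)"
        using x s S[OF x] by (auto simp: V_def cube_def \<phi>_def lattice_shift_def)
    qed
    then have "card (\<phi> ` (?Z \<times> S)) \<le> card (V \<inter> cube (real N * s))"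
      by (rule card_mono[OF fin])
    also have "card (\<phi> ` (?Z \<times> S)) = card (?Z \<times> S)"
      by (rule card_image, rule inj_on_subset[OF inj]) auto
    also have "\<dots> = N ^ CARD('n) * card S"
      by (simp add: card_cartesian_product card_PiE)
    finally show ?thesis
      by (metis of_nat_le_iff of_nat_mult of_nat_power)
  qed
  have "ereal (real (card S) / s ^ CARD('n)) \<le> upper_density V"
  \<comment> \<open>A smaller limit superior would keep the ratio below
    \<open>card S / s ^ d\<close> for all large \<open>T\<close>; this fails at
    \<open>T = N * s\<close>.\<close>
  proof (rule ccontr)
    assume "\<not> ?thesis"
    then have "\<forall>\<^sub>F T in at_top. ereal (real (card (V \<inter> cube T)) / T ^ CARD('n))
        < ereal (real (card S) / s ^ CARD('n))"
      unfolding upper_density_def not_le by (rule Limsup_lessD)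
    then obtain T0 where T0: "\<And>T. T \<ge> T0 \<Longrightarrow>
        real (card (V \<inter> cube T)) / T ^ CARD('n) < real (card S) / s ^ CARD('n)"
      by (auto simp: eventually_at_top_linorder)
    \<comment> \<open>The bound \<open>T0 / s\<close> puts \<open>N * s\<close> beyond
      \<open>T0\<close>; the bound 1 makes \<open>N\<close> positive, so that its powers
      cancel.\<close>
    obtain N :: nat where N: "max 1 (T0 / s) < real N"
      using reals_Archimedean2 by blast
    then have "real N * s \<ge> T0"
      using s by (simp add: field_simps)
    from T0[OF this]
    have "real (card (V \<inter> cube (real N * s))) / (real N * s) ^ CARD('n)
        < real (card S) / s ^ CARD('n)" .
    moreover have "real (card S) / s ^ CARD('n)
        = real N ^ CARD('n) * real (card S) / (real N * s) ^ CARD('n)"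
      using N s by (simp add: power_mult_distrib)
    ultimately have "real (card (V \<inter> cube (real N * s))) < real N ^ CARD('n) * real (card S)"
      using N s by (simp add: divide_less_cancel split: if_splits)
    then show False using card_V[of N] by simp
  qed
  also have "\<dots> \<le> g_max TYPE('n)"
    unfolding g_max_def using sep nonneg by (intro SUP_upper) auto
  finally show ?thesis by (simp add: s_def)
qed

section \<open>Expectations\<close>

text \<open>The law of \<open>N\<close> has the Poisson weights as density on the naturals, so the
  mean is a series. Computing it as a nonnegative integral yields integrability and the value
  together.\<close>

lemma (in prob_space) poisson_has_expectation:
  fixes N :: "'a \<Rightarrow> nat" and r :: real
  assumes N: "N \<in> M \<rightarrow>\<^sub>M count_space UNIV" and r: "r \<ge> 0"
    and dist: "\<And>n. prob {\<omega> \<in> space M. N \<omega> = n} = r ^ n / fact n * exp (- r)"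
  shows "integrable M (\<lambda>\<omega>. real (N \<omega>))" and "(\<integral>\<omega>. real (N \<omega>) \<partial>M) = r"
proof -
  have "(\<integral>\<^sup>+\<omega>. ennreal (real (N \<omega>)) \<partial>M) = (\<integral>\<^sup>+n. ennreal (real n) \<partial>distr M (count_space UNIV) N)"
    using N by (subst nn_integral_distr) auto
  also have "distr M (count_space UNIV) N
      = density (count_space UNIV) (\<lambda>n. ennreal (r ^ n / fact n * exp (- r)))"
  proof (rule measure_eqI_countable[where A = UNIV])
    fix n :: nat
    have "N -` {n} \<inter> space M = {\<omega> \<in> space M. N \<omega> = n}"
      by auto
    then show "emeasure (distr M (count_space UNIV) N) {n}
        = emeasure (density (count_space UNIV) (\<lambda>n. ennreal (r ^ n / fact n * exp (- r)))) {n}"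
      using N dist[of n] by (simp add: emeasure_distr emeasure_eq_measure emeasure_density
          nn_integral_count_space_indicator[symmetric])
  qed auto
  also have "(\<integral>\<^sup>+n. ennreal (real n) \<partial>density (count_space UNIV) (\<lambda>n. ennreal (r ^ n / fact n * exp (- r))))
      = (\<Sum>n. ennreal (r ^ n / fact n * exp (- r) * real n))"
    using r by (subst nn_integral_density)
      (auto simp: nn_integral_count_space_nat ennreal_mult'' simp del: times_divide_eq_left)
  also have "\<dots> = ennreal r"
  proof (rule suminf_ennreal_eq)
    have "(\<lambda>n. r ^ n / fact n) sums exp r"
      using exp_converges[of r] by (simp add: scaleR_conv_of_real field_simps)
    \<comment> \<open>As \<open>(n + 1) / (n + 1)! = 1 / n!\<close>, the mean series shifted by one
      is \<open>r * exp (- r)\<close> times the exponential series. The omitted term at index 0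
      vanishes.\<close>
    from sums_mult[OF this, of "r * exp (- r)"]
    have "(\<lambda>n. r * exp (- r) * (r ^ n / fact n)) sums r"
      by (simp add: mult.assoc flip: exp_add)
    moreover have "r * exp (- r) * (r ^ n / fact n)
        = r ^ Suc n / fact (Suc n) * exp (- r) * real (Suc n)" for n
      by (simp add: field_simps del: of_nat_Suc)
    ultimately have "(\<lambda>n. r ^ Suc n / fact (Suc n) * exp (- r) * real (Suc n)) sums r"
      by (simp only:)
    then show "(\<lambda>n. r ^ n / fact n * exp (- r) * real n) sums r"
      by (subst (asm) sums_Suc_iff) simp
  qed (use r in auto)
  finally have nn: "(\<integral>\<^sup>+\<omega>. ennreal (real (N \<omega>)) \<partial>M) = ennreal r" .
  have meas: "(\<lambda>\<omega>. real (N \<omega>)) \<in> borel_measurable M"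
    using N by simp
  show "integrable M (\<lambda>\<omega>. real (N \<omega>))"
    using nn by (intro integrableI_nonneg meas) auto
  show "(\<integral>\<omega>. real (N \<omega>) \<partial>M) = r"
    using nn r by (subst integral_eq_nn_integral[OF meas]) auto
qed

text \<open>Measurability of \<open>f\<close> is not needed since the integral of a nonintegrable function is 0.\<close>

lemma integral_le_of_nonneg:
  fixes f g :: "'a \<Rightarrow> real"
  assumes "integrable M g" "\<And>x. x \<in> space M \<Longrightarrow> 0 \<le> g x" "\<And>x. x \<in> space M \<Longrightarrow> f x \<le> g x"
  shows "(\<integral>x. f x \<partial>M) \<le> (\<integral>x. g x \<partial>M)"
proof (cases "integrable M f")
  case True
  then show ?thesis using assms by (intro integral_mono) auto
next
  case False
  then show ?thesis
    using assms by (simp add: not_integrable_integral_eq integral_nonneg)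
qed

section \<open>The two bounds on the constant\<close>

context poisson_point_process
begin

lemma finite_cube_Int: "\<omega> \<in> space M \<Longrightarrow> finite (cube t \<inter> X \<omega>)"
  using locally_finite[of \<omega> "cube t"] by (simp add: cube_eq_cbox Int_commute)

text \<open>A real infimum is a lower bound only for a set that is bounded below; here 0 bounds all
  the means.\<close>

lemma a_const_le_F_mean:
  assumes "t > 0" "l > 0"
  shows "a_const M l X k \<le> F_mean M l X k t"
  unfolding a_const_def
proof (rule cINF_lower)
  show "bdd_below (F_mean M l X k ` {0<..})"
    using assms(2) by (intro bdd_belowI[of _ 0]) (auto simp: F_mean_def)
qed (use assms in simp)

text \<open>Since \<open>a_const\<close> is an infimum, the single value \<open>t = 1\<close>
  suffices: the unit cube contains \<open>l\<close> points on average, and at most all of them can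
  be coloured.\<close>

lemma a_const_le_1:
  assumes "l > 0"
  shows "a_const M l X k \<le> 1"
proof -
  let ?N = "\<lambda>\<omega>. card (X \<omega> \<inter> cube 1)"
  have B: "(cube 1 :: (real ^ 'n) set) \<in> sets borel" "bounded (cube 1 :: (real ^ 'n) set)"
    by (auto simp: cube_eq_cbox)
  have vol: "measure lborel (cube 1 :: (real ^ 'n) set) = 1"
    by (simp add: measure_cube)
  have dist: "prob {\<omega> \<in> space M. ?N \<omega> = n} = l ^ n / fact n * exp (- l)" for n
    using poisson_counts[OF B, of n] by (simp add: vol)
  note N = poisson_has_expectation[OF measurable_counts[OF B] less_imp_le[OF assms] dist]
  have "(\<integral>\<omega>. real (F_count X k 1 \<omega>) \<partial>M) \<le> (\<integral>\<omega>. real (?N \<omega>) \<partial>M)"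
    using max_colorable_le_card[OF finite_cube_Int]
    by (intro integral_le_of_nonneg N(1)) (auto simp: F_count_def Int_commute)
  then have "F_mean M l X k 1 \<le> 1"
    using assms by (simp add: F_mean_def N(2))
  then show ?thesis
    using a_const_le_F_mean[of 1 k] assms by simp
qed

text \<open>Enlarging the side from \<open>t\<close> to \<open>t + 2\<close> costs a factor
  \<open>((t + 2) / t) ^ d\<close> in the bound. It tends to 1, while \<open>a_const\<close> does
  not depend on \<open>t\<close>.\<close>

lemma a_const_le_of_density_bound:
  assumes "l > 0"
    and g: "g_max TYPE('n) = ereal g"
  shows "a_const M l X k \<le> real k * g / l"
proof -
  have S: "real (card S) \<le> g * (t + 2) ^ CARD('n)"
    if "finite S" "S \<subseteq> cube t" "separated_set S" "t > 0" for S :: "(real ^ 'n) set" and t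
    using card_separated_le_g_max[OF that] that(4) by (simp add: g field_simps)
  \<comment> \<open>The empty set is separated. The sign of \<open>g\<close> makes the dominating
    constant \<open>?b\<close> nonnegative, as the comparison of integrals requires.\<close>
  have "g \<ge> 0"
    using card_separated_le_g_max[of "{} :: (real ^ 'n) set" 1] by (simp add: g separated_set_def)
  have "a_const M l X k \<le> real k * g / l * ((t + 2) / t) ^ CARD('n)" if t: "t > 0" for t
  proof -
    let ?b = "real k * (g * (t + 2) ^ CARD('n))"
    have "real (F_count X k t \<omega>) \<le> ?b" if \<omega>: "\<omega> \<in> space M" for \<omega>
      unfolding F_count_def
    proof (rule card_le_max_colorable_imp_le[OF finite_cube_Int[OF \<omega>]])
      fix U assume U: "U \<subseteq> cube t \<inter> X \<omega>" "colorable k (geometric_graph 1 U)"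
      have fin: "finite U"
        using U(1) finite_cube_Int[OF \<omega>] finite_subset by blast
      show "real (card U) \<le> ?b"
      proof (rule card_colorable_le[OF fin U(2)])
        fix S assume "S \<subseteq> U" "separated_set S"
        then show "real (card S) \<le> g * (t + 2) ^ CARD('n)"
          using U(1) fin t by (intro S) (auto intro: finite_subset)
      qed
    qed
    moreover have "?b \<ge> 0"
      using \<open>g \<ge> 0\<close> t by simp
    \<comment> \<open>The bound holds for every outcome, so the constant \<open>?b\<close>
      dominates; its integral over a probability space is \<open>?b\<close>.\<close>
    ultimately have "(\<integral>\<omega>. real (F_count X k t \<omega>) \<partial>M) \<le> (\<integral>\<omega>. ?b \<partial>M)"
      by (intro integral_le_of_nonneg) auto
    then have "F_mean M l X k t \<le> ?b / (l * t ^ CARD('n))"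
      using assms(1) t by (simp add: F_mean_def prob_space divide_right_mono)
    also have "\<dots> = real k * g / l * ((t + 2) / t) ^ CARD('n)"
      by (simp add: power_divide)
    finally show ?thesis
      using a_const_le_F_mean[OF t assms(1), of k] by simp
  qed
  then have "\<forall>\<^sub>F t in at_top. a_const M l X k \<le> real k * g / l * ((t + 2) / t) ^ CARD('n)"
    using eventually_gt_at_top[of "0::real"] by (rule eventually_mono[rotated])
  moreover have "((\<lambda>t::real. (t + 2) / t) \<longlongrightarrow> 1) at_top"
    by real_asymp
  then have "((\<lambda>t. real k * g / l * ((t + 2) / t) ^ CARD('n)) \<longlongrightarrow> real k * g / l * 1 ^ CARD('n)) at_top"
    by (intro tendsto_intros)
  ultimately have "a_const M l X k \<le> real k * g / l * 1 ^ CARD('n)"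
    by (intro tendsto_lowerbound) auto
  then show ?thesis by simp
qed

end

theorem mainTheorem5:
  fixes M :: "'w measure" and X :: "'w \<Rightarrow> (real ^ 'n::finite) set"
    and l :: real and k :: nat
  assumes "CARD('n) > 1"
    and "k \<ge> 1"
    and "l > 0"
    and "poisson_point_process M l X"
  shows "ereal (a_const M l X k) \<le> min 1 (ereal (real k) * g_max TYPE('n) / ereal l)"
proof -
  interpret poisson_point_process M l X by fact
  \<comment> \<open>This excludes the value minus infinity in the case distinction below.\<close>
  have "g_max TYPE('n) \<ge> 0"
    using card_separated_le_g_max[of "{} :: (real ^ 'n) set" 1]
    by (simp add: separated_set_def zero_ereal_def)
  then have "ereal (a_const M l X k) \<le> ereal (real k) * g_max TYPE('n) / ereal l"
  proof (cases "g_max TYPE('n)")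
    case (real g)
    then show ?thesis
      using a_const_le_of_density_bound[OF assms(3) real] assms(3) by simp
  next
    case PInf
    \<comment> \<open>As \<open>k\<close> is positive and \<open>l\<close> is positive and finite,
      the right-hand side is infinite.\<close>
    then show ?thesis using assms(2,3) by simp
  qed simp
  then show ?thesis
    using a_const_le_1[OF assms(3)] by (simp add: one_ereal_def)
qed

end
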